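(* Let $S$ be a $\Gamma$-semigroup and let $Q$ be any non-empty set. Then the following are equivalent: (1) $S$ is regular. (2) $\mu_1\circ\mu_2=\mu_1\cap\mu_2$ for every $Q$-fuzzy right ideal $\mu_1$ of $S$ and every $Q$-fuzzy left ideal $\mu_2$ of $S$.
   Context: $\Gamma$-semigroup: non-empty sets $S$ and $\Gamma$ together with mappings $S\times\Gamma\times S\to S$, $(a,\alpha,b)\mapsto a\alpha b$, and $\Gamma\times S\times\Gamma\to\Gamma$, $(\alpha,a,\beta)\mapsto\alpha a\beta$, such that $(a\alpha b)\beta c=a(\alpha b\beta)c=a\alpha(b\beta c)$ and $\alpha(a\beta b)\gamma=(\alpha a\beta)b\gamma=\alpha a(\beta b\gamma)$ for all $a,b,c\in S$ and $\alpha,\beta,\gamma\in\Gamma$; one says $S$ is a $\Gamma$-semigroup. It is regular if for each $x\in S$ there exists $\beta\in\Gamma$ with $x=x\beta x$. A $Q$-fuzzy subset of $S$ is a function $\mu:S\times Q\to[0,1]$; it is non-empty if it is not identically $0$. A non-empty $Q$-fuzzy subset $\mu$ of $S$ is a $Q$-fuzzy left ideal if $\mu(x\gamma y,q)\ge\mu(y,q)$, and a $Q$-fuzzy right ideal if $\mu(x\gamma y,q)\ge\mu(x,q)$, for all $x,y\in S,\gamma\in\Gamma,q\in Q$. For $Q$-fuzzy subsets $\mu_1,\mu_2$ of $S$: $(\mu_1\cap\mu_2)(x,q)=\min\{\mu_1(x,q),\mu_2(x,q)\}$, and the product is $(\mu_1\circ\mu_2)(x,q)=\sup\{\min\{\mu_1(u,q),\mu_2(v,q)\}: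 u,v\in S,\gamma\in\Gamma, x=u\gamma v\}$ if $x=u\gamma v$ for some $u,v\in S$, $\gamma\in\Gamma$, and $(\mu_1\circ\mu_2)(x,q)=0$ otherwise. *)

theory Defs
  imports Complex_Main "HOL-Library.FuncSet"
begin

locale gamma_semigroup =
  fixes S :: "'a set" and \<Gamma> :: "'g set"
    and smul :: "'a \<Rightarrow> 'g \<Rightarrow> 'a \<Rightarrow> 'a"
    and gmul :: "'g \<Rightarrow> 'a \<Rightarrow> 'g \<Rightarrow> 'g"
  assumes S_nonempty: "S \<noteq> {}"
    and Gamma_nonempty: "\<Gamma> \<noteq> {}"
    and smul_closed: "\<lbrakk>a \<in> S; \<alpha> \<in> \<Gamma>; b \<in> S\<rbrakk> \<Longrightarrow> smul a \<alpha> b \<in> S"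
    and gmul_closed: "\<lbrakk>\<alpha> \<in> \<Gamma>; a \<in> S; \<beta> \<in> \<Gamma>\<rbrakk> \<Longrightarrow> gmul \<alpha> a \<beta> \<in> \<Gamma>"
    and smul_assoc_mid:
      "\<lbrakk>a \<in> S; b \<in> S; c \<in> S; \<alpha> \<in> \<Gamma>; \<beta> \<in> \<Gamma>\<rbrakk>
        \<Longrightarrow> smul (smul a \<alpha> b) \<beta> c = smul a (gmul \<alpha> b \<beta>) c"
    and smul_assoc_right:
      "\<lbrakk>a \<in> S; b \<in> S; c \<in> S; \<alpha> \<in> \<Gamma>; \<beta> \<in> \<Gamma>\<rbrakk>
        \<Longrightarrow> smul a (gmul \<alpha> b \<beta>) c = smul a \<alpha> (smul b \<beta> c)"
    and gmul_assoc_mid: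
      "\<lbrakk>a \<in> S; b \<in> S; \<alpha> \<in> \<Gamma>; \<beta> \<in> \<Gamma>; \<gamma> \<in> \<Gamma>\<rbrakk>
        \<Longrightarrow> gmul \<alpha> (smul a \<beta> b) \<gamma> = gmul (gmul \<alpha> a \<beta>) b \<gamma>"
    and gmul_assoc_right:
      "\<lbrakk>a \<in> S; b \<in> S; \<alpha> \<in> \<Gamma>; \<beta> \<in> \<Gamma>; \<gamma> \<in> \<Gamma>\<rbrakk>
        \<Longrightarrow> gmul (gmul \<alpha> a \<beta>) b \<gamma> = gmul \<alpha> a (gmul \<beta> b \<gamma>)"

definition regular_gamma ::
  "'a set \<Rightarrow> 'g set \<Rightarrow> ('a \<Rightarrow> 'g \<Rightarrow> 'a \<Rightarrow> 'a) \<Rightarrow> bool" where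
  "regular_gamma S \<Gamma> smul \<longleftrightarrow> (\<forall>x\<in>S. \<exists>\<beta>\<in>\<Gamma>. x = smul x \<beta> x)"

text \<open>Functions on \<open>S \<times> Q\<close> are extensional (fixed to \<open>undefined\<close> outside
  \<open>S \<times> Q\<close>), so that HOL equality of fuzzy subsets is equality of functions on \<open>S \<times> Q\<close>.\<close>

definition fuzzy_subsets :: "'a set \<Rightarrow> 'q set \<Rightarrow> ('a \<times> 'q \<Rightarrow> real) set" where
  "fuzzy_subsets S Q = (S \<times> Q \<rightarrow>\<^sub>E {0..1})"

definition fuzzy_nonempty :: "'a set \<Rightarrow> 'q set \<Rightarrow> ('a \<times> 'q \<Rightarrow> real) \<Rightarrow> bool" where
  "fuzzy_nonempty S Q \<mu> \<longleftrightarrow> (\<exists>x\<in>S. \<exists>q\<in>Q. \<mu> (x, q) \<noteq> 0)"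

definition fuzzy_left_ideal ::
  "'a set \<Rightarrow> 'g set \<Rightarrow> ('a \<Rightarrow> 'g \<Rightarrow> 'a \<Rightarrow> 'a) \<Rightarrow> 'q set \<Rightarrow> ('a \<times> 'q \<Rightarrow> real) \<Rightarrow> bool" where
  "fuzzy_left_ideal S \<Gamma> smul Q \<mu> \<longleftrightarrow>
    \<mu> \<in> fuzzy_subsets S Q \<and> fuzzy_nonempty S Q \<mu> \<and>
    (\<forall>x\<in>S. \<forall>y\<in>S. \<forall>\<gamma>\<in>\<Gamma>. \<forall>q\<in>Q. \<mu> (smul x \<gamma> y, q) \<ge> \<mu> (y, q))"

definition fuzzy_right_ideal ::
  "'a set \<Rightarrow> 'g set \<Rightarrow> ('a \<Rightarrow> 'g \<Rightarrow> 'a \<Rightarrow> 'a) \<Rightarrow> 'q set \<Rightarrow> ('a \<times> 'q \<Rightarrow> real) \<Rightarrow> bool" where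
  "fuzzy_right_ideal S \<Gamma> smul Q \<mu> \<longleftrightarrow>
    \<mu> \<in> fuzzy_subsets S Q \<and> fuzzy_nonempty S Q \<mu> \<and>
    (\<forall>x\<in>S. \<forall>y\<in>S. \<forall>\<gamma>\<in>\<Gamma>. \<forall>q\<in>Q. \<mu> (smul x \<gamma> y, q) \<ge> \<mu> (x, q))"

definition fuzzy_inter ::
  "'a set \<Rightarrow> 'q set \<Rightarrow> ('a \<times> 'q \<Rightarrow> real) \<Rightarrow> ('a \<times> 'q \<Rightarrow> real) \<Rightarrow> ('a \<times> 'q \<Rightarrow> real)" where
  "fuzzy_inter S Q \<mu>1 \<mu>2 = (\<lambda>(x, q)\<in>S \<times> Q. min (\<mu>1 (x, q)) (\<mu>2 (x, q)))"

definition fuzzy_prod ::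
  "'a set \<Rightarrow> 'g set \<Rightarrow> ('a \<Rightarrow> 'g \<Rightarrow> 'a \<Rightarrow> 'a) \<Rightarrow> 'q set \<Rightarrow>
    ('a \<times> 'q \<Rightarrow> real) \<Rightarrow> ('a \<times> 'q \<Rightarrow> real) \<Rightarrow> ('a \<times> 'q \<Rightarrow> real)" where
  "fuzzy_prod S \<Gamma> smul Q \<mu>1 \<mu>2 = (\<lambda>(x, q)\<in>S \<times> Q.
    if \<exists>u\<in>S. \<exists>v\<in>S. \<exists>\<gamma>\<in>\<Gamma>. x = smul u \<gamma> v
    then Sup {min (\<mu>1 (u, q)) (\<mu>2 (v, q)) | u v \<gamma>.
                u \<in> S \<and> v \<in> S \<and> \<gamma> \<in> \<Gamma> \<and> x = smul u \<gamma> v}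
    else 0)"

end

theory Submission imports Defs begin

text \<open>For a right ideal \<open>\<mu>1\<close> and a left ideal \<open>\<mu>2\<close>, every factorisation \<open>x = u\<gamma>v\<close> contributes at
  most \<open>min (\<mu>1 x) (\<mu>2 x)\<close> to the product, and in a regular \<open>\<Gamma>\<close>-semigroup the factorisation
  \<open>x = x\<beta>x\<close> attains this bound. Conversely, apply the product formula to the indicators of the
  principal right ideal \<open>{x} \<union> x\<Gamma>S\<close> and the principal left ideal \<open>{x} \<union> S\<Gamma>x\<close>: the product must
  be \<open>1\<close> at \<open>x\<close>, so \<open>x = u\<gamma>v\<close> with \<open>u\<close> and \<open>v\<close> in these ideals, and associativity brings
  \<open>u\<gamma>v\<close> into the form \<open>x\<beta>x\<close>.\<close>

lemma (in gamma_semigroup) fuzzy_prod_eq_inter_if_regular: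
  assumes reg: "regular_gamma S \<Gamma> smul"
    and right: "fuzzy_right_ideal S \<Gamma> smul Q \<mu>1"
    and left: "fuzzy_left_ideal S \<Gamma> smul Q \<mu>2"
  shows "fuzzy_prod S \<Gamma> smul Q \<mu>1 \<mu>2 = fuzzy_inter S Q \<mu>1 \<mu>2"
proof
  fix p
  show "fuzzy_prod S \<Gamma> smul Q \<mu>1 \<mu>2 p = fuzzy_inter S Q \<mu>1 \<mu>2 p"
  \<comment> \<open>Off \<open>S \<times> Q\<close> both sides are \<open>undefined\<close> by
    extensionality, so only genuine pairs need an argument.\<close>
  proof (cases "p \<in> S \<times> Q")
    case False
    then show ?thesis by (simp add: fuzzy_prod_def fuzzy_inter_def)
  next
    case True
    then obtain x q where p: "p = (x, q)" and x: "x \<in> S" and q: "q \<in> Q" by blast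
    obtain \<beta> where \<beta>: "\<beta> \<in> \<Gamma>" "x = smul x \<beta> x"
      using reg x unfolding regular_gamma_def by blast
    let ?A = "{min (\<mu>1 (u, q)) (\<mu>2 (v, q)) | u v \<gamma>.
                u \<in> S \<and> v \<in> S \<and> \<gamma> \<in> \<Gamma> \<and> x = smul u \<gamma> v}"
    have "Sup ?A = min (\<mu>1 (x, q)) (\<mu>2 (x, q))"
    proof (rule cSup_eq_maximum)
      show "min (\<mu>1 (x, q)) (\<mu>2 (x, q)) \<in> ?A" using x \<beta> by blast
    next
      fix y assume "y \<in> ?A"
      then obtain u v \<gamma> where uv: "u \<in> S" "v \<in> S" "\<gamma> \<in> \<Gamma>" "x = smul u \<gamma> v"
        and y: "y = min (\<mu>1 (u, q)) (\<mu>2 (v, q))" by blast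
      have "\<mu>1 (u, q) \<le> \<mu>1 (x, q)"
        using right uv q unfolding fuzzy_right_ideal_def by blast
      moreover have "\<mu>2 (v, q) \<le> \<mu>2 (x, q)"
        using left uv q unfolding fuzzy_left_ideal_def by blast
      ultimately show "y \<le> min (\<mu>1 (x, q)) (\<mu>2 (x, q))"
        unfolding y by (rule min.mono)
    qed
    moreover have "\<exists>u\<in>S. \<exists>v\<in>S. \<exists>\<gamma>\<in>\<Gamma>. x = smul u \<gamma> v" using x \<beta> by blast
    ultimately show ?thesis using x q by (simp add: p fuzzy_prod_def fuzzy_inter_def)
  qed
qed

definition fuzzy_indicator :: "'a set \<Rightarrow> 'q set \<Rightarrow> 'a set \<Rightarrow> 'a \<times> 'q \<Rightarrow> real" where
  "fuzzy_indicator S Q A = (\<lambda>(x, q)\<in>S \<times> Q. if x \<in> A then 1 else 0)"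

lemma fuzzy_indicator_apply:
  "x \<in> S \<Longrightarrow> q \<in> Q \<Longrightarrow> fuzzy_indicator S Q A (x, q) = (if x \<in> A then 1 else 0)"
  by (simp add: fuzzy_indicator_def)

lemma fuzzy_indicator_subset: "fuzzy_indicator S Q A \<in> fuzzy_subsets S Q"
  by (auto simp: fuzzy_indicator_def fuzzy_subsets_def)

lemma fuzzy_indicator_nonempty:
  "x \<in> S \<inter> A \<Longrightarrow> Q \<noteq> {} \<Longrightarrow> fuzzy_nonempty S Q (fuzzy_indicator S Q A)"
  unfolding fuzzy_nonempty_def using fuzzy_indicator_apply[of x S _ Q A] by fastforce

context gamma_semigroup
begin

text \<open>The ideal inequality can fail only where the indicator is 1 at the left factor, and
  there closure of \<open>A\<close> makes it 1 at the product too. The point \<open>x\<close> serves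
  only to make the fuzzy subset non-empty.\<close>

lemma fuzzy_right_ideal_indicator:
  assumes "x \<in> S \<inter> A" and "Q \<noteq> {}"
    and "\<And>u \<gamma> s. \<lbrakk>u \<in> S \<inter> A; \<gamma> \<in> \<Gamma>; s \<in> S\<rbrakk> \<Longrightarrow> smul u \<gamma> s \<in> A"
  shows "fuzzy_right_ideal S \<Gamma> smul Q (fuzzy_indicator S Q A)"
  unfolding fuzzy_right_ideal_def
  using assms
  by (auto simp: fuzzy_indicator_subset fuzzy_indicator_apply smul_closed
      intro: fuzzy_indicator_nonempty[OF assms(1,2)])

lemma fuzzy_left_ideal_indicator:
  assumes "x \<in> S \<inter> A" and "Q \<noteq> {}"
    and "\<And>s \<gamma> v. \<lbrakk>s \<in> S; \<gamma> \<in> \<Gamma>; v \<in> S \<inter> A\<rbrakk> \<Longrightarrow> smul s \<gamma> v \<in> A"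
  shows "fuzzy_left_ideal S \<Gamma> smul Q (fuzzy_indicator S Q A)"
  unfolding fuzzy_left_ideal_def
  using assms
  by (auto simp: fuzzy_indicator_subset fuzzy_indicator_apply smul_closed
      intro: fuzzy_indicator_nonempty[OF assms(1,2)])

text \<open>In each factorisation of \<open>x\<close> one factor misses its set, so the minimum is
  0. Read contrapositively, a non-zero product at \<open>x\<close> yields a factorisation with
  factors in \<open>A\<close> and \<open>B\<close>.\<close>

lemma fuzzy_prod_indicator_eq_0:
  assumes x: "x \<in> S" and q: "q \<in> Q"
    and none: "\<And>u v \<gamma>. \<lbrakk>u \<in> S \<inter> A; v \<in> S \<inter> B; \<gamma> \<in> \<Gamma>\<rbrakk> \<Longrightarrow> x \<noteq> smul u \<gamma> v"
  shows "fuzzy_prod S \<Gamma> smul Q (fuzzy_indicator S Q A) (fuzzy_indicator S Q B) (x, q) = 0"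
proof (cases "\<exists>u\<in>S. \<exists>v\<in>S. \<exists>\<gamma>\<in>\<Gamma>. x = smul u \<gamma> v")
  case True
  let ?\<mu> = "fuzzy_indicator S Q A" and ?\<nu> = "fuzzy_indicator S Q B"
  let ?C = "{min (?\<mu> (u, q)) (?\<nu> (v, q)) | u v \<gamma>.
                u \<in> S \<and> v \<in> S \<and> \<gamma> \<in> \<Gamma> \<and> x = smul u \<gamma> v}"
  have "min (?\<mu> (u, q)) (?\<nu> (v, q)) = 0"
    if "u \<in> S" "v \<in> S" "\<gamma> \<in> \<Gamma>" "x = smul u \<gamma> v" for u v \<gamma>
    using none[of u v \<gamma>] that q by (auto simp: fuzzy_indicator_apply)
  then have "?C \<subseteq> {0}" by blast
  \<comment> \<open>This rules out the empty set, whose real supremum has no meaningful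
    value.\<close>
  moreover have "?C \<noteq> {}" using True by blast
  ultimately have "?C = {0}" by (simp only: subset_singleton_iff simp_thms)
  then have "Sup ?C = 0" by (simp only: cSup_singleton)
  then show ?thesis using x q True by (simp add: fuzzy_prod_def)
qed (use x q in \<open>simp add: fuzzy_prod_def\<close>)

lemma regular_if_fuzzy_prod_eq_inter:
  fixes Q :: "'q set"
  assumes Q: "Q \<noteq> {}"
    and eq: "\<And>\<mu>1 \<mu>2. \<lbrakk>fuzzy_right_ideal S \<Gamma> smul Q \<mu>1; fuzzy_left_ideal S \<Gamma> smul Q \<mu>2\<rbrakk>
      \<Longrightarrow> fuzzy_prod S \<Gamma> smul Q \<mu>1 \<mu>2 = fuzzy_inter S Q \<mu>1 \<mu>2"
  shows "regular_gamma S \<Gamma> smul"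
  unfolding regular_gamma_def
proof
  fix x assume x: "x \<in> S"
  obtain q where q: "q \<in> Q" using Q by blast
  \<comment> \<open>The point \<open>x\<close> is inserted by hand: before regularity is known, it
    need not be a multiple of itself.\<close>
  define R where "R = insert x {smul x \<gamma> s | \<gamma> s. \<gamma> \<in> \<Gamma> \<and> s \<in> S}"
  define L where "L = insert x {smul s \<gamma> x | \<gamma> s. \<gamma> \<in> \<Gamma> \<and> s \<in> S}"
  have assoc: "smul (smul a \<alpha> b) \<beta> c = smul a \<alpha> (smul b \<beta> c)"
    if "a \<in> S" "b \<in> S" "c \<in> S" "\<alpha> \<in> \<Gamma>" "\<beta> \<in> \<Gamma>" for a b c \<alpha> \<beta>
    using that by (simp add: smul_assoc_mid smul_assoc_right)
  have "smul u \<gamma> s \<in> R" if "u \<in> S \<inter> R" "\<gamma> \<in> \<Gamma>" "s \<in> S" for u \<gamma> s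
  proof (cases "u = x")
    case False
    then obtain \<delta> t where "\<delta> \<in> \<Gamma>" "t \<in> S" "u = smul x \<delta> t"
      using \<open>u \<in> S \<inter> R\<close> by (auto simp: R_def)
    then have "smul u \<gamma> s = smul x \<delta> (smul t \<gamma> s)" "smul t \<gamma> s \<in> S"
      using that x by (simp_all add: assoc smul_closed)
    with \<open>\<delta> \<in> \<Gamma>\<close> show ?thesis unfolding R_def by blast
  qed (use that in \<open>auto simp: R_def\<close>)
  then have right: "fuzzy_right_ideal S \<Gamma> smul Q (fuzzy_indicator S Q R)"
    using x Q by (intro fuzzy_right_ideal_indicator[of x]) (auto simp: R_def)
  have "smul s \<gamma> v \<in> L" if "s \<in> S" "\<gamma> \<in> \<Gamma>" "v \<in> S \<inter> L" for s \<gamma> v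
  proof (cases "v = x")
    case False
    then obtain \<delta> t where "\<delta> \<in> \<Gamma>" "t \<in> S" "v = smul t \<delta> x"
      using \<open>v \<in> S \<inter> L\<close> by (auto simp: L_def)
    then have "smul s \<gamma> v = smul (smul s \<gamma> t) \<delta> x" "smul s \<gamma> t \<in> S"
      using that x by (simp_all add: assoc smul_closed)
    with \<open>\<delta> \<in> \<Gamma>\<close> show ?thesis unfolding L_def by blast
  qed (use that in \<open>auto simp: L_def\<close>)
  then have left: "fuzzy_left_ideal S \<Gamma> smul Q (fuzzy_indicator S Q L)"
    using x Q by (intro fuzzy_left_ideal_indicator[of x]) (auto simp: L_def)
  have "fuzzy_prod S \<Gamma> smul Q (fuzzy_indicator S Q R) (fuzzy_indicator S Q L) (x, q) = 1"
    using x q unfolding eq[OF right left]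
    by (simp add: fuzzy_inter_def fuzzy_indicator_apply R_def L_def)
  \<comment> \<open>Since 1 is not 0, the vanishing lemma must fail to apply, which gives the
    factorisation.\<close>
  then obtain u v \<gamma> where u: "u \<in> R" and v: "v \<in> L" and vS: "v \<in> S"
    and \<gamma>: "\<gamma> \<in> \<Gamma>" and xuv: "x = smul u \<gamma> v"
    using fuzzy_prod_indicator_eq_0[OF x q, of R L] by fastforce
  \<comment> \<open>The left factor becomes \<open>x\<close>: if \<open>u\<close> is
    \<open>smul x \<alpha> s\<close>, then \<open>s\<close> is absorbed into the operator
    \<open>gmul \<alpha> s \<gamma>\<close>, which stays in \<open>\<Gamma>\<close>.\<close>
  obtain \<delta> where \<delta>: "\<delta> \<in> \<Gamma>" "x = smul x \<delta> v"
  proof (cases "u = x")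
    case False
    then obtain \<alpha> s where "\<alpha> \<in> \<Gamma>" "s \<in> S" "u = smul x \<alpha> s" using u by (auto simp: R_def)
    then have "smul u \<gamma> v = smul x (gmul \<alpha> s \<gamma>) v" "gmul \<alpha> s \<gamma> \<in> \<Gamma>"
      using x vS \<gamma> by (simp_all add: smul_assoc_mid gmul_closed)
    then show ?thesis using that xuv by metis
  qed (use that \<gamma> xuv in blast)
  \<comment> \<open>The right factor is treated in the same way, with
    \<open>gmul \<delta> t \<alpha>\<close> as the final witness when \<open>v\<close> is not
    \<open>x\<close>.\<close>
  show "\<exists>\<beta>\<in>\<Gamma>. x = smul x \<beta> x"
  proof (cases "v = x")
    case False
    then obtain \<alpha> t where "\<alpha> \<in> \<Gamma>" "t \<in> S" "v = smul t \<alpha> x" using v by (auto simp: L_def)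
    then have "smul x \<delta> v = smul x (gmul \<delta> t \<alpha>) x" "gmul \<delta> t \<alpha> \<in> \<Gamma>"
      using \<delta>(1) x by (simp_all add: smul_assoc_right gmul_closed)
    then show ?thesis using \<delta>(2) by metis
  qed (use \<delta> in blast)
qed

end

theorem theorem4p7:
  fixes S :: "'a set" and \<Gamma> :: "'g set" and Q :: "'q set"
    and smul :: "'a \<Rightarrow> 'g \<Rightarrow> 'a \<Rightarrow> 'a"
    and gmul :: "'g \<Rightarrow> 'a \<Rightarrow> 'g \<Rightarrow> 'g"
  assumes "gamma_semigroup S \<Gamma> smul gmul"
    and "Q \<noteq> {}"
  shows "regular_gamma S \<Gamma> smul \<longleftrightarrow>
    (\<forall>\<mu>1 \<mu>2. fuzzy_right_ideal S \<Gamma> smul Q \<mu>1 \<longrightarrow> fuzzy_left_ideal S \<Gamma> smul Q \<mu>2 \<longrightarrow>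
      fuzzy_prod S \<Gamma> smul Q \<mu>1 \<mu>2 = fuzzy_inter S Q \<mu>1 \<mu>2)"
  using gamma_semigroup.fuzzy_prod_eq_inter_if_regular[OF assms(1)]
    gamma_semigroup.regular_if_fuzzy_prod_eq_inter[OF assms]
  by blast

end
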